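(* There is a constant $C>0$, independent of $\alpha$, such that for every irrational $\alpha\in\mathbb{R}/\mathbb{Z}$ there is $R=R(\alpha)>0$ with $$\mathscr{B}_\alpha(r)\le C\sqrt{r}\qquad\text{for all } r\ge R.$$ Moreover, if $\alpha$ is Diophantine of exponent $\nu\ge 2$, then there are constants $c>0$ and $R'>0$ (which may depend on $\alpha$ and $\nu$) such that $$\mathscr{B}_\alpha(r)\ge c\, r^{1/(2\nu-2)}\qquad\text{for all } r\ge R'.$$
   Context: Fix once and for all a number $\varepsilon$ with $0<\varepsilon\le\varepsilon_4$, where $\varepsilon_4>0$ is the Margulis constant of hyperbolic 4-space $\mathbb{H}^4$, and put $c(\varepsilon)=1/\sqrt{2\cosh(\varepsilon)-2}$ (constants may depend on this fixed $\varepsilon$). For irrational $\alpha\in\mathbb{R}/\mathbb{Z}$ and each integer $j\ge1$ let $$u_{\alpha,j}(r)=c(\varepsilon)\sqrt{4\sin^2(\pi j\alpha)\,r^2+j^2}\qquad(r\ge0),$$ and define the boundary function $\mathscr{B}_\alpha:[0,\infty)\to\mathbb{R}$ by $\mathscr{B}_\alpha(r)=\inf_{j\ge1}u_{\alpha,j}(r)$. An irrational $\alpha$ is Diophantine of exponent $\nu\ge2$ if there is a constant $\kappa>0$ such that $|\alpha-p/q|>\kappa/|q|^{\nu}$ for every rational number $p/q$. *)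

theory Defs
  imports "HOL-Analysis.Analysis" "HOL-Algebra.Bij" "HOL-Algebra.Coset"
    "HOL-Algebra.Generated_Groups"
begin

text \<open>
  Hyperbolic 4-space in the upper half-space model, with the metric determined by
  cosh d(p, q) = 1 + |p - q|^2 / (2 s t), where s, t are the heights of p and q and
  |p - q| is the Euclidean distance.
\<close>

definition H4 :: "((real ^ 3) \<times> real) set" where
  "H4 = {p. 0 < snd p}"

definition hdist :: "(real ^ 3) \<times> real \<Rightarrow> (real ^ 3) \<times> real \<Rightarrow> real" where
  "hdist p q = arcosh (1 + (dist p q)\<^sup>2 / (2 * snd p * snd q))"

definition hyp_isometries :: "((real ^ 3) \<times> real \<Rightarrow> (real ^ 3) \<times> real) set" where
  "hyp_isometries = {g \<in> Bij H4. \<forall>p\<in>H4. \<forall>q\<in>H4. hdist (g p) (g q) = hdist p q}"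

definition isom_H4 :: "((real ^ 3) \<times> real \<Rightarrow> (real ^ 3) \<times> real) monoid" where
  "isom_H4 = (BijGroup H4)\<lparr>carrier := hyp_isometries\<rparr>"

text \<open>
  Discreteness refers to the topology of pointwise convergence, which on the isometry group
  is the same as the compact-open topology. The Euclidean subspace topology on the upper
  half-space is the one induced by the hyperbolic metric.
\<close>

definition discrete_isometry_group :: "((real ^ 3) \<times> real \<Rightarrow> (real ^ 3) \<times> real) set \<Rightarrow> bool" where
  "discrete_isometry_group \<Gamma> \<longleftrightarrow>
     subgroup \<Gamma> isom_H4 \<and>
     subtopology (product_topology (\<lambda>_. top_of_set H4) H4) \<Gamma> = discrete_topology \<Gamma>"

primrec lower_central :: "('a, 'b) monoid_scheme \<Rightarrow> nat \<Rightarrow> 'a set" where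
  "lower_central G 0 = carrier G"
| "lower_central G (Suc n) =
     generate G {x \<otimes>\<^bsub>G\<^esub> y \<otimes>\<^bsub>G\<^esub> (inv\<^bsub>G\<^esub> x) \<otimes>\<^bsub>G\<^esub> (inv\<^bsub>G\<^esub> y) | x y.
                   x \<in> lower_central G n \<and> y \<in> carrier G}"

definition nilpotent_group :: "('a, 'b) monoid_scheme \<Rightarrow> bool" where
  "nilpotent_group G \<longleftrightarrow> group G \<and> (\<exists>n. lower_central G n = {\<one>\<^bsub>G\<^esub>})"

definition virtually_nilpotent :: "('a, 'b) monoid_scheme \<Rightarrow> bool" where
  "virtually_nilpotent G \<longleftrightarrow> group G \<and>
     (\<exists>H. subgroup H G \<and> finite (rcosets\<^bsub>G\<^esub> H) \<and> nilpotent_group (G\<lparr>carrier := H\<rparr>))"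

text \<open>
  The largest e such that, for every discrete group of isometries and every point p, the
  elements moving p by less than e generate a virtually nilpotent group. The set below is
  nonempty by the Margulis lemma, bounded above, and, because of the strict inequality and
  discreteness, contains its supremum.
\<close>

definition margulis_constant :: real where
  "margulis_constant = Sup {e. 0 < e \<and>
     (\<forall>\<Gamma> p. discrete_isometry_group \<Gamma> \<longrightarrow> p \<in> H4 \<longrightarrow>
        virtually_nilpotent
          (isom_H4\<lparr>carrier := generate isom_H4 {g \<in> \<Gamma>. hdist p (g p) < e}\<rparr>))}"

text \<open>
  Elements of R/Z are represented by real numbers. The functions below for integral j, and
  the Diophantine condition, are invariant under translating \<open>\<alpha>\<close> by an integer.
\<close>

definition c_eps :: "real \<Rightarrow> real" where
  "c_eps \<epsilon> = 1 / sqrt (2 * cosh \<epsilon> - 2)"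

definition u_fun :: "real \<Rightarrow> real \<Rightarrow> nat \<Rightarrow> real \<Rightarrow> real" where
  "u_fun \<epsilon> \<alpha> j r = c_eps \<epsilon> * sqrt (4 * (sin (pi * real j * \<alpha>))\<^sup>2 * r\<^sup>2 + (real j)\<^sup>2)"

definition boundary_fun :: "real \<Rightarrow> real \<Rightarrow> real \<Rightarrow> real" where
  "boundary_fun \<epsilon> \<alpha> r = (INF j\<in>{1..}. u_fun \<epsilon> \<alpha> j r)"

definition diophantine :: "real \<Rightarrow> real \<Rightarrow> bool" where
  "diophantine \<nu> \<alpha> \<longleftrightarrow> \<alpha> \<notin> \<rat> \<and>
     (\<exists>\<kappa>>0. \<forall>p q :: int. q \<noteq> 0 \<longrightarrow>
        \<bar>\<alpha> - real_of_int p / real_of_int q\<bar> > \<kappa> / \<bar>real_of_int q\<bar> powr \<nu>)"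

end

theory Submission
  imports Defs
begin

text \<open>
  Write \<open>\<parallel>x\<parallel>\<close> for the distance from \<open>x\<close> to the nearest integer. The whole argument rests on
  \<open>2 * \<parallel>x\<parallel> \<le> \<bar>sin (pi * x)\<bar> \<le> pi * \<parallel>x\<parallel>\<close> (lemmas \<open>abs_sin_pi_ge\<close> and \<open>abs_sin_pi_le\<close>): up to bounded
  factors, \<open>u_fun \<epsilon> \<alpha> j r\<close> is the larger of \<open>j\<close> and \<open>\<parallel>j * \<alpha>\<parallel> * r\<close>, so the size of the boundary
  function is a question about rational approximation of \<open>\<alpha>\<close>.

  Upper bound: Dirichlet's theorem, used with denominators up to \<open>sqrt r\<close>, gives one \<open>j \<le> sqrt r\<close>
  for which \<open>\<parallel>j * \<alpha>\<parallel> * r\<close> is at most of order \<open>sqrt r\<close> too. The constants in this do not depend on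
  \<open>\<alpha>\<close>, and even the threshold can be taken to be \<open>1\<close>.

  Lower bound: the Diophantine condition says that \<open>\<parallel>j * \<alpha>\<parallel>\<close> is at least \<open>\<kappa> / j powr (\<nu> - 1)\<close>.
  With \<open>s = r powr (1 / (2 * \<nu> - 2))\<close> there are two cases. If \<open>j \<ge> s\<close>, the term \<open>j\<close> is already
  large enough. If \<open>j < s\<close>, then \<open>j powr (\<nu> - 1)\<close> is less than \<open>s powr (\<nu> - 1) = sqrt r\<close>, so
  \<open>\<parallel>j * \<alpha>\<parallel> * r\<close> is at least a multiple of \<open>sqrt r\<close>, and \<open>sqrt r \<ge> s\<close> because \<open>\<nu> \<ge> 2\<close>.
\<close>

lemma abs_sin_pi_diff_int:
  fixes x :: real and p :: int
  shows "\<bar>sin (pi * (x - of_int p))\<bar> = \<bar>sin (pi * x)\<bar>"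
proof -
  have "\<bar>cos (pi * of_int p)\<bar> = 1"
    using sin_zero_abs_cos_one sin_npi_int by blast
  then show ?thesis
    by (simp add: right_diff_distrib sin_diff abs_mult)
qed

lemma abs_sin_pi_le:
  fixes x :: real and p :: int
  shows "\<bar>sin (pi * x)\<bar> \<le> pi * \<bar>x - of_int p\<bar>"
  using abs_sin_x_le_abs_x[of "pi * (x - of_int p)"]
  by (simp only: abs_sin_pi_diff_int) (simp add: abs_mult)

text \<open>
  The sine is concave on \<open>[0, pi / 2]\<close>, so it lies above its chord there (Jordan's inequality).
\<close>

lemma sin_half_pi_times_ge:
  fixes t :: real
  assumes "0 \<le> t" "t \<le> 1"
  shows "t \<le> sin (t * (pi / 2))"
proof -
  have "convex_on {0..pi / 2} (\<lambda>x. - sin x)"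
  proof (rule f''_ge0_imp_convex)
    show "((\<lambda>x. - sin x) has_real_derivative - cos x) (at x)" for x :: real
      by (auto intro!: derivative_eq_intros)
    show "((\<lambda>x. - cos x) has_real_derivative sin x) (at x)" for x :: real
      by (auto intro!: derivative_eq_intros)
  qed (auto intro: sin_ge_zero)
  from convex_onD[OF this, of t 0 "pi / 2"] assms show ?thesis
    by simp
qed

lemma abs_sin_pi_ge:
  fixes x d :: real
  assumes "\<And>p::int. d \<le> \<bar>x - of_int p\<bar>"
  shows "2 * d \<le> \<bar>sin (pi * x)\<bar>"
proof -
  define y where "y = \<bar>x - of_int (round x)\<bar>"
  have "y \<le> 1 / 2"
    using of_int_round_abs_le[of x] by (simp add: y_def abs_minus_commute)
  then have "2 * y \<le> sin (pi * y)"
    using sin_half_pi_times_ge[of "2 * y"] by (simp add: y_def mult.commute)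
  also have "\<dots> \<le> \<bar>sin (pi * (x - of_int (round x)))\<bar>"
  proof -
    have "sin (pi * \<bar>z\<bar>) \<le> \<bar>sin (pi * z)\<bar>" for z :: real
      by (cases "0 \<le> z") auto
    then show ?thesis unfolding y_def .
  qed
  finally show ?thesis
    using assms[of "round x"] by (simp add: abs_sin_pi_diff_int y_def)
qed

lemma c_eps_nonneg: "0 \<le> c_eps \<epsilon>"
  using cosh_real_ge_1[of \<epsilon>] by (simp add: c_eps_def)

lemma c_eps_pos:
  assumes "0 < \<epsilon>"
  shows "0 < c_eps \<epsilon>"
  using cosh_real_strict_mono[of 0 \<epsilon>] assms by (simp add: c_eps_def)

lemma boundary_fun_le_u_fun:
  assumes "1 \<le> j"
  shows "boundary_fun \<epsilon> \<alpha> r \<le> u_fun \<epsilon> \<alpha> j r"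
  unfolding boundary_fun_def
proof (rule cINF_lower)
  show "bdd_below ((\<lambda>j. u_fun \<epsilon> \<alpha> j r) ` {1..})"
    by (rule bdd_belowI2[where m = 0]) (simp add: u_fun_def c_eps_nonneg)
qed (use assms in simp)

lemma u_fun_ge_index: "c_eps \<epsilon> * real j \<le> u_fun \<epsilon> \<alpha> j r"
  unfolding u_fun_def
  by (intro mult_left_mono c_eps_nonneg real_le_rsqrt) simp

lemma u_fun_ge_sin:
  assumes "0 \<le> r"
  shows "c_eps \<epsilon> * (2 * \<bar>sin (pi * real j * \<alpha>)\<bar> * r) \<le> u_fun \<epsilon> \<alpha> j r"
  unfolding u_fun_def
  by (intro mult_left_mono c_eps_nonneg real_le_rsqrt) (simp add: power_mult_distrib)

lemma boundary_fun_le_sqrt: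
  fixes r :: real
  assumes r: "1 \<le> r"
  shows "boundary_fun \<epsilon> \<alpha> r \<le> c_eps \<epsilon> * sqrt (16 * pi\<^sup>2 + 1) * sqrt r"
proof -
  define N where "N = nat \<lfloor>sqrt r\<rfloor>"
  have sqrt1: "1 \<le> sqrt r" using r by simp
  then have N: "0 < N" "real N \<le> sqrt r" "sqrt r < real N + 1"
    unfolding N_def by linarith+
  then have N_half: "sqrt r \<le> 2 * real N"
    by linarith
  obtain h k where k: "0 < k" "k \<le> int N" and hk: "\<bar>of_int k * \<alpha> - of_int h\<bar> < 1 / N"
    using Dirichlet_approx[OF N(1)] by blast
  define j where "j = nat k"
  have j: "1 \<le> j" "real j \<le> sqrt r" and jk: "real j = of_int k"
    using k N(2) by (auto simp: j_def)
  have "\<bar>sin (pi * real j * \<alpha>)\<bar> \<le> pi * \<bar>of_int k * \<alpha> - of_int h\<bar>"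
    using abs_sin_pi_le[of "of_int k * \<alpha>" h] by (simp add: jk mult.assoc)
  also have "\<dots> \<le> pi * (1 / N)"
    using hk by (intro mult_left_mono) auto
  also have "\<dots> = pi * (2 / (2 * real N))"
    by simp
  also have "\<dots> \<le> pi * (2 / sqrt r)"
    using N_half sqrt1 r N(1) by (intro mult_left_mono divide_left_mono) auto
  finally have "\<bar>sin (pi * real j * \<alpha>)\<bar> * r \<le> pi * (2 / sqrt r) * r"
    using r by (intro mult_right_mono) auto
  also have "\<dots> = 2 * pi * sqrt r"
    using r by (simp add: field_simps)
  finally have "(\<bar>sin (pi * real j * \<alpha>)\<bar> * r)\<^sup>2 \<le> (2 * pi * sqrt r)\<^sup>2"
    using r by (intro power_mono) auto
  moreover have "(real j)\<^sup>2 \<le> (sqrt r)\<^sup>2"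
    using j(2) by (intro power_mono) auto
  ultimately have "4 * (sin (pi * real j * \<alpha>))\<^sup>2 * r\<^sup>2 + (real j)\<^sup>2 \<le> (16 * pi\<^sup>2 + 1) * r"
    using r by (simp add: power_mult_distrib algebra_simps)
  then have "u_fun \<epsilon> \<alpha> j r \<le> c_eps \<epsilon> * sqrt ((16 * pi\<^sup>2 + 1) * r)"
    unfolding u_fun_def by (intro mult_left_mono c_eps_nonneg real_sqrt_le_mono)
  with boundary_fun_le_u_fun[OF j(1), of \<epsilon> \<alpha> r] show ?thesis
    by (simp add: real_sqrt_mult mult.assoc)
qed

lemma diophantine_abs_sin_ge:
  assumes "diophantine \<nu> \<alpha>"
  obtains \<kappa> where "0 < \<kappa>"
    "\<And>j. 1 \<le> j \<Longrightarrow> 2 * (\<kappa> / real j powr (\<nu> - 1)) \<le> \<bar>sin (pi * real j * \<alpha>)\<bar>"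
proof -
  obtain \<kappa> where "0 < \<kappa>" and approx:
    "\<And>p q :: int. q \<noteq> 0 \<Longrightarrow> \<bar>\<alpha> - of_int p / of_int q\<bar> > \<kappa> / \<bar>of_int q\<bar> powr \<nu>"
    using assms unfolding diophantine_def by blast
  have "2 * (\<kappa> / real j powr (\<nu> - 1)) \<le> \<bar>sin (pi * real j * \<alpha>)\<bar>" if "1 \<le> j" for j
  proof -
    have "\<kappa> / real j powr (\<nu> - 1) \<le> \<bar>real j * \<alpha> - of_int p\<bar>" for p :: int
    proof -
      have "\<kappa> / real j powr (\<nu> - 1) = real j * (\<kappa> / real j powr \<nu>)"
        using that by (simp add: powr_diff)
      also have "\<dots> \<le> real j * \<bar>\<alpha> - of_int p / real j\<bar>"
        using approx[of "int j" p] that by (intro mult_left_mono) auto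
      also have "\<dots> = \<bar>real j * (\<alpha> - of_int p / real j)\<bar>"
        by (simp add: abs_mult)
      also have "real j * (\<alpha> - of_int p / real j) = real j * \<alpha> - of_int p"
        using that by (simp add: field_simps)
      finally show ?thesis .
    qed
    then show ?thesis
      using abs_sin_pi_ge[of "\<kappa> / real j powr (\<nu> - 1)" "real j * \<alpha>"] by (simp add: mult.assoc)
  qed
  with \<open>0 < \<kappa>\<close> show ?thesis by (rule that)
qed

text \<open>
  The exponent \<open>1 / (2 * \<nu> - 2)\<close> is the one for which \<open>j = r powr (1 / (2 * \<nu> - 2))\<close> turns the
  Diophantine bound for \<open>\<parallel>j * \<alpha>\<parallel> * r\<close> into \<open>\<kappa> * sqrt r\<close>, the order that Dirichlet's theorem allows. Balancing
  \<open>j\<close> against \<open>r / j powr (\<nu> - 1)\<close> would give the exponent \<open>1 / \<nu>\<close>, which is at least as large and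
  agrees with it for \<open>\<nu> = 2\<close>.
\<close>

lemma boundary_fun_ge_powr:
  fixes r \<nu> \<kappa> :: real
  assumes r: "1 \<le> r" and \<nu>: "2 \<le> \<nu>" and \<kappa>: "0 < \<kappa>"
    and sin_ge: "\<And>j. 1 \<le> j \<Longrightarrow> 2 * (\<kappa> / real j powr (\<nu> - 1)) \<le> \<bar>sin (pi * real j * \<alpha>)\<bar>"
  shows "c_eps \<epsilon> * min 1 (4 * \<kappa>) * r powr (1 / (2 * \<nu> - 2)) \<le> boundary_fun \<epsilon> \<alpha> r"
proof -
  define s where "s = r powr (1 / (2 * \<nu> - 2))"
  have s_pos: "0 < s" using r by (simp add: s_def)
  have s_le: "s \<le> sqrt r"
    unfolding s_def powr_half_sqrt[symmetric, OF order_trans[OF zero_le_one r]]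
    using r \<nu> by (intro powr_mono) (auto simp: field_simps)
  have s_powr: "s powr (\<nu> - 1) = sqrt r"
  proof -
    have "1 / (2 * \<nu> - 2) * (\<nu> - 1) = 1 / 2" using \<nu> by (simp add: field_simps)
    then show ?thesis using r unfolding s_def powr_powr by (simp only: powr_half_sqrt)
  qed
  have "c_eps \<epsilon> * min 1 (4 * \<kappa>) * s \<le> u_fun \<epsilon> \<alpha> j r" if j: "1 \<le> j" for j
  proof (cases "s \<le> real j")
    case True
    then have "min 1 (4 * \<kappa>) * s \<le> 1 * real j"
      using s_pos by (intro mult_mono) auto
    then have "c_eps \<epsilon> * (min 1 (4 * \<kappa>) * s) \<le> c_eps \<epsilon> * real j"
      by (intro mult_left_mono c_eps_nonneg) simp
    with u_fun_ge_index[of \<epsilon> j \<alpha> r] show ?thesis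
      by (simp add: mult.assoc)
  next
    case False
    have "real j powr (\<nu> - 1) \<le> sqrt r"
      unfolding s_powr[symmetric] using False \<nu> by (intro powr_mono2) auto
    then have "2 * (\<kappa> / sqrt r) \<le> 2 * (\<kappa> / real j powr (\<nu> - 1))"
      using \<kappa> r j by (intro mult_left_mono divide_left_mono) auto
    also note sin_ge[OF j]
    finally have "2 * (2 * (\<kappa> / sqrt r)) * r \<le> 2 * \<bar>sin (pi * real j * \<alpha>)\<bar> * r"
      using r by (intro mult_right_mono mult_left_mono) auto
    moreover have "2 * (2 * (\<kappa> / sqrt r)) * r = 4 * \<kappa> * sqrt r"
      using r by (simp add: field_simps)
    moreover have "min 1 (4 * \<kappa>) * s \<le> 4 * \<kappa> * sqrt r"
      using s_le s_pos \<kappa> by (intro mult_mono) auto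
    ultimately have "min 1 (4 * \<kappa>) * s \<le> 2 * \<bar>sin (pi * real j * \<alpha>)\<bar> * r"
      by linarith
    then have "c_eps \<epsilon> * (min 1 (4 * \<kappa>) * s) \<le> c_eps \<epsilon> * (2 * \<bar>sin (pi * real j * \<alpha>)\<bar> * r)"
      by (intro mult_left_mono c_eps_nonneg)
    with u_fun_ge_sin[of r \<epsilon> j \<alpha>] r show ?thesis
      by (simp add: mult.assoc)
  qed
  then show ?thesis
    unfolding boundary_fun_def s_def[symmetric] by (intro cINF_greatest) auto
qed

theorem theoremA:
  fixes \<epsilon> :: real
  assumes "0 < \<epsilon>" and "\<epsilon> \<le> margulis_constant"
  shows "(\<exists>C>0. \<forall>\<alpha>::real. \<alpha> \<notin> \<rat> \<longrightarrow>
            (\<exists>R>0. \<forall>r\<ge>R. boundary_fun \<epsilon> \<alpha> r \<le> C * sqrt r)) \<and>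
         (\<forall>(\<alpha>::real) (\<nu>::real). 2 \<le> \<nu> \<and> diophantine \<nu> \<alpha> \<longrightarrow>
            (\<exists>c>0. \<exists>R'>0. \<forall>r\<ge>R'. boundary_fun \<epsilon> \<alpha> r \<ge> c * r powr (1 / (2 * \<nu> - 2))))"
proof (intro conjI allI impI)
  have "0 < c_eps \<epsilon> * sqrt (16 * pi\<^sup>2 + 1)"
    using c_eps_pos[OF assms(1)] by (simp add: add_nonneg_pos)
  then show "\<exists>C>0. \<forall>\<alpha>::real. \<alpha> \<notin> \<rat> \<longrightarrow>
      (\<exists>R>0. \<forall>r\<ge>R. boundary_fun \<epsilon> \<alpha> r \<le> C * sqrt r)"
    using boundary_fun_le_sqrt zero_less_one by blast
next
  fix \<alpha> \<nu> :: real
  assume *: "2 \<le> \<nu> \<and> diophantine \<nu> \<alpha>"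
  then obtain \<kappa> where \<kappa>: "0 < \<kappa>"
    "\<And>j. 1 \<le> j \<Longrightarrow> 2 * (\<kappa> / real j powr (\<nu> - 1)) \<le> \<bar>sin (pi * real j * \<alpha>)\<bar>"
    using diophantine_abs_sin_ge by blast
  have "0 < c_eps \<epsilon> * min 1 (4 * \<kappa>)"
    using c_eps_pos[OF assms(1)] \<kappa>(1) by simp
  moreover have "\<forall>r\<ge>1. boundary_fun \<epsilon> \<alpha> r \<ge> c_eps \<epsilon> * min 1 (4 * \<kappa>) * r powr (1 / (2 * \<nu> - 2))"
    using boundary_fun_ge_powr[OF _ conjunct1[OF *] \<kappa>] by blast
  ultimately show "\<exists>c>0. \<exists>R'>0. \<forall>r\<ge>R'. boundary_fun \<epsilon> \<alpha> r \<ge> c * r powr (1 / (2 * \<nu> - 2))"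
    using zero_less_one by blast
qed

end
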